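(* Let $\theta=[0;a_1,a_2,\dots]\in(0,1)$ be an irrational number with bounded partial quotients. Then the set $\mathscr{L}(\theta)=\{\operatorname{rep}(\mathbf{x}) : \mathbf{x}\text{ is a Sturmian word of slope }\theta\}$ has a minimum, and $$\min\mathscr{L}(\theta)=\liminf_{k\to\infty}\,[1;1+a_k,a_{k-1},a_{k-2},\dots,a_1].$$
   Context: Continued fractions: $[a_0;a_1,a_2,\dots]=a_0+\cfrac{1}{a_1+\cfrac{1}{a_2+\cdots}}$, with $a_0\in\mathbb{Z}$ and $a_n\in\mathbb{Z}_{>0}$ for $n\ge1$ (and similarly for finite expansions). The number has bounded partial quotients if the sequence $(a_n)$ is bounded. Sturmian words: for an irrational $\theta\in(0,1)$, a Sturmian word of slope $\theta$ is an infinite word $\mathbf{x}=x_1x_2\dots$ over $\{0,1\}$ for which there is a real number $\rho$ such that either $x_n=\lfloor (n+1)\theta+\rho\rfloor-\lfloor n\theta+\rho\rfloor$ for all $n\ge1$, or $x_n=\lceil (n+1)\theta+\rho\rceil-\lceil n\theta+\rho\rceil$ for all $n\ge1$. Exponent of repetition: for an infinite word $\mathbf{x}=x_1x_2\dots$ and $n\ge1$, $$r(n,\mathbf{x})=\min\{m : x_jx_{j+1}\dots x_{j+n-1}=x_{m-n+1}x_{m-n+2}\dots x_m\text{ for some }1\le j\le m-n\},$$ and $\operatorname{rep}(\mathbf{x})=\liminf_{n\to\infty} r(n,\mathbf{x})/n$. *)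

theory Defs
  imports Complex_Main "HOL-Library.Extended_Real" "HOL-Library.Liminf_Limsup"
begin

text \<open>The finite continued fraction $[a_0;a_1,\dots,a_n]$ as a function of the list of its
  partial quotients; the value on the empty list is a dummy.\<close>

fun fin_cfrac :: "int list \<Rightarrow> real" where
  "fin_cfrac [] = 0"
| "fin_cfrac [a] = of_int a"
| "fin_cfrac (a # b # as) = of_int a + 1 / fin_cfrac (b # as)"

definition has_cfrac :: "real \<Rightarrow> (nat \<Rightarrow> int) \<Rightarrow> bool" where
  "has_cfrac \<theta> a \<longleftrightarrow>
     (\<forall>n\<ge>1. a n > 0) \<and> (\<lambda>n. fin_cfrac (map a [0..<Suc n])) \<longlonglongrightarrow> \<theta>"

text \<open>Infinite words are functions on the natural numbers whose letters are the values at
  indices \<open>\<ge> 1\<close>; the value at \<open>0\<close> is not part of the word and nothing below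
  depends on it.\<close>

definition sturmian_word :: "real \<Rightarrow> (nat \<Rightarrow> int) \<Rightarrow> bool" where
  "sturmian_word \<theta> x \<longleftrightarrow> \<theta> \<notin> \<rat> \<and> 0 < \<theta> \<and> \<theta> < 1 \<and> (\<forall>n\<ge>1. x n \<in> {0, 1}) \<and>
     (\<exists>\<rho>::real.
        (\<forall>n\<ge>1. x n = \<lfloor>(real n + 1) * \<theta> + \<rho>\<rfloor> - \<lfloor>real n * \<theta> + \<rho>\<rfloor>) \<or>
        (\<forall>n\<ge>1. x n = \<lceil>(real n + 1) * \<theta> + \<rho>\<rceil> - \<lceil>real n * \<theta> + \<rho>\<rceil>))"

text \<open>Such an \<open>m\<close> exists for every word over a finite alphabet, by the pigeonhole principle.
  The condition \<open>j + n \<le> m\<close> is $j \le m - n$, and it makes the subtraction on the naturals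
  exact.\<close>

definition rep_length :: "nat \<Rightarrow> (nat \<Rightarrow> 'a) \<Rightarrow> nat" where
  "rep_length n x =
     (LEAST m. \<exists>j\<ge>1. j + n \<le> m \<and> (\<forall>i<n. x (j + i) = x (m - n + 1 + i)))"

definition rep :: "(nat \<Rightarrow> 'a) \<Rightarrow> ereal" where
  "rep x = liminf (\<lambda>n. ereal (real (rep_length n x) / real n))"

definition rep_spectrum :: "real \<Rightarrow> ereal set" where
  "rep_spectrum \<theta> = {rep x | x. sturmian_word \<theta> x}"

end

theory Submission
  imports Defs "HOL-Analysis.Extended_Real_Limits"
begin

text \<open>Let $p_k/q_k$ be the convergents of $\theta$ and $\eta_k = |q_k\theta - p_k|$. Since
  $q_k/q_{k-1} = [a_k;a_{k-1},\dots,a_1]$, the continued fraction in the theorem equals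
  $1 + q_{k-1}/(q_{k-1}+q_k)$.

  If a Sturmian word agrees with its shift by $d$ on a window of length $n$, then $n+1$ consecutive
  points of the rotation by $\theta$ avoid an interval of length $|d\theta-P|$ for some integer $P$.
  For $q_k \le d < q_{k+1}$ this length is at least $\eta_k$, and every interval of length $\eta_k$
  is hit within $q_k+q_{k+1}$ steps, so $n+2 \le q_k+q_{k+1}$ and
  $r(n,\mathbf{x})/n \ge 1+d/n \ge 1 + q_k/(q_k+q_{k+1})$.

  Conversely, agreement with the shift by $q_k$ persists for the maximal length $q_k+q_{k+1}-2$ when the
  starting point of the orbit lies in a certain interval of length $\eta_{k+1}$ close to $0$. Pulling
  these intervals back along the dense orbit of $0$ shows that the intercepts $\rho$ whose word has some
  $r(n,\mathbf{x})/n$ almost as small as the lower limit contain a dense open set, and Baire's theorem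
  gives one $\rho$ that works at infinitely many $n$.\<close>

section \<open>Convergents\<close>

fun cf_num :: "(nat \<Rightarrow> int) \<Rightarrow> nat \<Rightarrow> int" where
  "cf_num a 0 = a 0"
| "cf_num a (Suc 0) = a 1 * a 0 + 1"
| "cf_num a (Suc (Suc n)) = a (Suc (Suc n)) * cf_num a (Suc n) + cf_num a n"

fun cf_den :: "(nat \<Rightarrow> int) \<Rightarrow> nat \<Rightarrow> int" where
  "cf_den a 0 = 1"
| "cf_den a (Suc 0) = a 1"
| "cf_den a (Suc (Suc n)) = a (Suc (Suc n)) * cf_den a (Suc n) + cf_den a n"

lemma cf_det: "cf_den a n * cf_num a (Suc n) - cf_den a (Suc n) * cf_num a n = (-1) ^ n"
  by (induction n) (simp_all add: algebra_simps)

lemma cf_den_pos: "(\<And>n. n \<ge> 1 \<Longrightarrow> a n > 0) \<Longrightarrow> cf_den a n > 0"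
  by (induction a n rule: cf_den.induct) (simp_all add: add_pos_pos)

lemma fin_cfrac_Cons: "xs \<noteq> [] \<Longrightarrow> fin_cfrac (b # xs) = of_int b + 1 / fin_cfrac xs"
  by (cases xs) auto

lemma fin_cfrac_snoc:
  "fin_cfrac (xs @ [b]) = foldr (\<lambda>c t. of_int c + 1 / t) xs (of_int b)"
  by (induction xs) (simp_all add: fin_cfrac_Cons)

text \<open>A continued fraction with a real tail \<open>t\<close> is a Moebius transformation of
  \<open>t\<close> whose matrix holds two consecutive convergents. The induction is general in
  \<open>t\<close>, so that the last quotient can be absorbed into the tail as
  \<open>b + 1 / t\<close>.\<close>

lemma foldr_cfrac_eq:
  fixes t :: real
  assumes pos: "\<And>n. n \<ge> 1 \<Longrightarrow> a n > 0" and "t > 0"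
  shows "foldr (\<lambda>c t. of_int c + 1 / t) (map a [0..<Suc (Suc n)]) t =
    (cf_num a (Suc n) * t + cf_num a n) / (cf_den a (Suc n) * t + cf_den a n)"
  using \<open>t > 0\<close>
proof (induction n arbitrary: t)
  case 0
  have "0 < real_of_int (a 1)"
    using pos[of 1] by simp
  then have "0 < real_of_int (a 1) * t + 1"
    using 0 by (simp add: add_pos_pos)
  then show ?case
    using 0 by (simp add: divide_simps) (simp add: algebra_simps)
next
  case (Suc n)
  define b where "b = real_of_int (a (Suc (Suc n)))"
  have "b > 0"
    using pos[of "Suc (Suc n)"] by (simp add: b_def)
  have q: "real_of_int (cf_den a n) > 0" "real_of_int (cf_den a (Suc n)) > 0"
    using cf_den_pos[of a] pos by auto
  have "foldr (\<lambda>c t. of_int c + 1 / t) (map a [0..<Suc (Suc (Suc n))]) t =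
      foldr (\<lambda>c t. of_int c + 1 / t) (map a [0..<Suc (Suc n)]) (b + 1 / t)"
    by (simp add: b_def)
  also have "\<dots> = (cf_num a (Suc n) * (b + 1 / t) + cf_num a n) /
      (cf_den a (Suc n) * (b + 1 / t) + cf_den a n)"
    using \<open>b > 0\<close> Suc.prems by (intro Suc.IH) (simp add: add_pos_pos)
  also have "\<dots> = (t * (cf_num a (Suc n) * (b + 1 / t) + cf_num a n)) /
      (t * (cf_den a (Suc n) * (b + 1 / t) + cf_den a n))"
    using Suc.prems by simp
  also have "t * (cf_num a (Suc n) * (b + 1 / t) + cf_num a n) =
      cf_num a (Suc (Suc n)) * t + cf_num a (Suc n)"
    using Suc.prems by (simp add: b_def field_simps)
  also have "t * (cf_den a (Suc n) * (b + 1 / t) + cf_den a n) =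
      cf_den a (Suc (Suc n)) * t + cf_den a (Suc n)"
    using Suc.prems by (simp add: b_def field_simps)
  finally show ?case .
qed

lemma fin_cfrac_eq_convergent:
  assumes pos: "\<And>n. n \<ge> 1 \<Longrightarrow> a n > 0"
  shows "fin_cfrac (map a [0..<Suc n]) = cf_num a n / cf_den a n"
proof -
  consider "n = 0" | "n = 1" | m where "n = Suc (Suc m)"
    by (metis One_nat_def not0_implies_Suc)
  then show ?thesis
  proof cases
    case 2
    then show ?thesis
      using pos[of 1] by (simp add: field_simps)
  next
    case 3
    have "fin_cfrac (map a [0..<Suc n]) =
        foldr (\<lambda>c t. of_int c + 1 / t) (map a [0..<Suc (Suc m)]) (of_int (a n))"
      using fin_cfrac_snoc[of "map a [0..<Suc (Suc m)]" "a n"] by (simp add: 3)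
    also have "\<dots> = cf_num a n / cf_den a n"
      using foldr_cfrac_eq[of a "of_int (a n)" m, OF pos] pos[of n]
      by (simp add: 3 mult.commute)
    finally show ?thesis .
  qed simp
qed

text \<open>Dividing the recursion for the denominators by q_{k+1} gives q_{k+2}/q_{k+1} = a_{k+2} +
  1/(q_{k+1}/q_k), which unfolds to the reversed list of quotients.\<close>

lemma fin_cfrac_rev_eq:
  assumes pos: "\<And>n. n \<ge> 1 \<Longrightarrow> a n > 0"
  shows "fin_cfrac (map a (rev [1..<Suc (Suc k)])) = cf_den a (Suc k) / cf_den a k"
proof (induction k)
  case (Suc k)
  have q: "cf_den a n > 0" for n
    using cf_den_pos[of a] pos by auto
  have "fin_cfrac (map a (rev [1..<Suc (Suc (Suc k))])) =
      fin_cfrac (a (Suc (Suc k)) # map a (rev [1..<Suc (Suc k)]))"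
    by simp
  also have "\<dots> = a (Suc (Suc k)) + cf_den a k / cf_den a (Suc k)"
    by (subst fin_cfrac_Cons) (simp_all only: Suc.IH, simp_all)
  finally show ?case
    using q[of "Suc k"] by (simp add: field_simps)
qed simp

text \<open>Raising the leading quotient of q_{k+1}/q_k by 1 turns it into (q_k + q_{k+1})/q_k; the
  outer \<open>1\<close> then inverts this.\<close>

lemma fin_cfrac_target_eq:
  assumes pos: "\<And>n. n \<ge> 1 \<Longrightarrow> a n > 0"
  shows "fin_cfrac (1 # (1 + a (Suc k)) # map a (rev [1..<Suc k])) =
    1 + cf_den a k / (cf_den a k + cf_den a (Suc k))"
proof (cases k)
  case (Suc m)
  have q: "real_of_int (cf_den a n) > 0" for n
    using cf_den_pos[of a] pos by auto
  have "fin_cfrac ((1 + a (Suc k)) # map a (rev [1..<Suc k])) =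
      1 + a (Suc k) + cf_den a m / cf_den a (Suc m)"
    unfolding Suc
    by (subst fin_cfrac_Cons) (simp_all only: fin_cfrac_rev_eq[of a, OF pos], simp_all)
  also have "\<dots> = (cf_den a k + cf_den a (Suc k)) / cf_den a k"
    using q[of k] by (simp add: Suc field_simps)
  finally show ?thesis
    by (subst fin_cfrac_Cons) simp_all
qed simp

declare cf_num.simps(3) [simp del] cf_den.simps(3) [simp del]

section \<open>Rotations\<close>

text \<open>Measure the orbit points from \<open>u\<close> modulo 1 and take the one with the
  largest fractional part. Another point of the segment lies at most \<open>D\<close> ahead of it;
  by maximality it must wrap past 1, so it lands in [0, D).\<close>

lemma orbit_hits_interval:
  fixes \<alpha> \<delta> \<delta>' D z u :: real and Q Q' :: nat and P P' :: int
  assumes "Q > 0" and step: "\<alpha> * Q = P + \<delta>" "\<alpha> * Q' = P' - \<delta>'"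
    and "0 < \<delta>" "\<delta> \<le> D" "0 < \<delta>'" "\<delta>' \<le> D"
  shows "\<exists>i<Q + Q'. \<exists>m::int. u \<le> z + i * \<alpha> + m \<and> z + i * \<alpha> + m < u + D"
proof -
  define f where "f i = frac (z + real i * \<alpha> - u)" for i
  define M where "M = Max (f ` {..<Q + Q'})"
  have "M \<in> f ` {..<Q + Q'}"
    unfolding M_def using \<open>Q > 0\<close> by (intro Max_in) auto
  then obtain i where i: "i < Q + Q'" "f i = M"
    by auto
  have max: "f j \<le> f i" if "j < Q + Q'" for j
    using that i(2) by (simp add: M_def)
  \<comment> \<open>Every point of the orbit segment has another one at distance \<open>\<delta>\<close> or \<open>\<delta>'\<close> ahead of it.\<close>
  obtain j s and m :: int where j: "j < Q + Q'" "0 < s" "s \<le> D" "real j * \<alpha> = real i * \<alpha> + s + m"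
  \<comment> \<open>Going \<open>Q\<close> steps forward advances by \<open>\<delta>\<close>, going
    \<open>Q'\<close> steps back advances by \<open>\<delta>'\<close>; for each \<open>i\<close> one
    of the two stays inside the segment.\<close>
  proof (cases "i < Q'")
    case True
    then show ?thesis
      using assms by (intro that[of "i + Q" \<delta> P]) (auto simp: algebra_simps)
  next
    case False
    then show ?thesis
      using assms i by (intro that[of "i - Q'" \<delta>' "- P'"]) (auto simp: algebra_simps of_nat_diff)
  qed
  define c where "c = m + \<lfloor>z + real i * \<alpha> - u\<rfloor>"
  have eq: "z + real j * \<alpha> - u = f i + s + c"
    using j(4) by (simp add: f_def frac_def c_def)
  have "f i + s \<ge> 1"
  proof (rule ccontr)
    assume "\<not> f i + s \<ge> 1"
    then have "f j = f i + s"
      unfolding f_def[of j] eq using j(2) by (subst frac_unique_iff) (auto simp: f_def add_nonneg_pos less_imp_le)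
    then show False
      using max[OF j(1)] j(2) by simp
  qed
  moreover have "f i < 1"
    by (simp add: f_def frac_lt_1)
  ultimately show ?thesis
    using j(1,3) eq by (intro exI[of _ j] conjI exI[of _ "- c - 1"]) auto
qed

section \<open>Unimodular pairs of approximations from opposite sides\<close>

locale convergent_pair =
  fixes \<alpha> \<delta> \<delta>' :: real and P P' Q Q' :: int
  assumes det: "Q * P' - Q' * P = 1"
    and pos: "0 < Q" "0 < Q'" "0 < \<delta>" "0 < \<delta>'"
    and near: "\<alpha> * Q = P + \<delta>" "\<alpha> * Q' = P' - \<delta>'"
begin

lemma decompose:
  fixes l N :: int
  obtains x y :: int where "l = x * Q + y * Q'" "l * \<alpha> - N = x * \<delta> - y * \<delta>'"
proof
  \<comment> \<open>Cramer's rule: the vectors (Q, P) and (Q', P') form a basis of the integer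
    lattice because their determinant is 1, and \<open>x\<close>, \<open>y\<close> are the
    coordinates of (l, N).\<close>
  define x y where "x = l * P' - N * Q'" and "y = N * Q - l * P"
  have "x * Q + y * Q' = l * (Q * P' - Q' * P)"
    by (simp add: x_def y_def algebra_simps)
  then show l: "l = x * Q + y * Q'"
    by (simp add: det)
  have "x * P + y * P' = N * (Q * P' - Q' * P)"
    by (simp add: x_def y_def algebra_simps)
  then have N: "N = x * P + y * P'"
    by (simp add: det)
  have "l * \<alpha> - N = x * (\<alpha> * Q) + y * (\<alpha> * Q') - (x * P + y * P')"
    by (subst l, subst N) (simp add: algebra_simps)
  then show "l * \<alpha> - N = x * \<delta> - y * \<delta>'"
    unfolding near by (simp add: algebra_simps)
qed

text \<open>In lattice coordinates, x \<ge> 1 and an error below \<open>\<delta>\<close> force y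
  \<ge> 1, hence l \<ge> Q + Q'; x \<le> 0 and an error above \<open>- \<delta>'\<close> force y
  \<le> 0, hence l \<le> 0.\<close>

lemma no_early_return:
  fixes l N :: int
  assumes "0 < l" "l < Q + Q'"
  shows "\<not> (- \<delta>' < l * \<alpha> - N \<and> l * \<alpha> - N < \<delta>)"
proof
  assume near_N: "- \<delta>' < l * \<alpha> - N \<and> l * \<alpha> - N < \<delta>"
  obtain x y where xy: "l = x * Q + y * Q'" "l * \<alpha> - N = x * \<delta> - y * \<delta>'"
    by (rule decompose)
  show False
  proof (cases "x \<ge> 1")
    case True
    then have "real_of_int x * \<delta> \<ge> \<delta>"
      using pos by simp
    then have "real_of_int y * \<delta>' > 0"
      using near_N xy by simp
    then have "y \<ge> 1"
      using pos by (simp add: zero_less_mult_iff)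
    then have "x * Q + y * Q' \<ge> 1 * Q + 1 * Q'"
      using True pos by (intro add_mono mult_right_mono) auto
    then show False
      using xy assms by simp
  next
    case False
    then have "real_of_int x * \<delta> \<le> 0"
      using pos by (simp add: mult_le_0_iff)
    then have "real_of_int y * \<delta>' < 1 * \<delta>'"
      using near_N xy by simp
    then have "y \<le> 0"
      using pos by (subst (asm) mult_less_cancel_right_pos) auto
    then have "x * Q + y * Q' \<le> 0"
      using False pos by (intro add_nonpos_nonpos) (auto simp: mult_le_0_iff)
    then show False
      using xy assms by simp
  qed
qed

text \<open>Suppose the error is smaller than \<open>\<delta>\<close> in absolute value. In lattice
  coordinates x = 0 makes \<open>l\<close> a multiple of \<open>Q'\<close>, x \<ge> 1 forces y \<ge>
  1, and x \<le> -1 forces y \<le> 0; each contradicts 0 < l < Q'.\<close>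

lemma best_approximation:
  fixes l N :: int
  assumes "0 < l" "l < Q'"
  shows "\<delta> \<le> \<bar>l * \<alpha> - N\<bar>"
proof (rule ccontr)
  assume less: "\<not> ?thesis"
  obtain x y where xy: "l = x * Q + y * Q'" "l * \<alpha> - N = x * \<delta> - y * \<delta>'"
    by (rule decompose)
  have bounds: "- \<delta> < x * \<delta> - y * \<delta>'" "x * \<delta> - y * \<delta>' < \<delta>"
    using less unfolding xy(2) by linarith+
  have "l * \<alpha> - N \<le> - \<delta>'"
    using no_early_return[of l N] assms pos less by auto
  moreover have "x \<noteq> 0"
  proof
    assume "x = 0"
    then have "y > 0" "y < 1"
      using xy assms pos by (auto simp: zero_less_mult_iff)
    then show False
      by simp
  qed
  moreover have "x < 1"
  proof (rule ccontr)
    assume "\<not> x < 1"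
    then have *: "real_of_int x * \<delta> \<ge> \<delta>"
      using pos by simp
    then have "real_of_int y * \<delta>' > 0"
      using bounds by linarith
    then have "y \<ge> 1"
      using pos by (simp add: zero_less_mult_iff)
    then have "x * Q + y * Q' \<ge> 1 * Q + 1 * Q'"
      using \<open>\<not> x < 1\<close> pos by (intro add_mono mult_right_mono) auto
    then show False
      using xy assms pos by simp
  qed
  ultimately have "x \<le> -1"
    by simp
  then have "real_of_int x * \<delta> \<le> - 1 * \<delta>"
    using pos by (intro mult_right_mono) auto
  then have "real_of_int y * \<delta>' < 0"
    using bounds by simp
  then have "y \<le> 0"
    using pos by (simp add: mult_less_0_iff)
  then have "x * Q + y * Q' \<le> 0"
    using \<open>x \<le> -1\<close> pos by (intro add_nonpos_nonpos) (auto simp: mult_le_0_iff)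
  then show False
    using xy assms by simp
qed

end


section \<open>Denominators and approximation errors of the convergents\<close>

locale cfrac_expansion =
  fixes \<theta> :: real and a :: "nat \<Rightarrow> int"
  assumes irrational: "\<theta> \<notin> \<rat>" and expansion: "has_cfrac \<theta> a"
begin

abbreviation p :: "nat \<Rightarrow> int" where "p \<equiv> cf_num a"
abbreviation q :: "nat \<Rightarrow> int" where "q \<equiv> cf_den a"

text \<open>This is the distance |q_n \<theta> - p_n|; writing it with a sign instead of an absolute
  value keeps it linear in p_n and q_n, so it inherits their recursion.\<close>

definition gap :: "nat \<Rightarrow> real" where
  "gap n = (-1) ^ n * (q n * \<theta> - p n)"

lemma quotient_pos: "n \<ge> 1 \<Longrightarrow> a n > 0"
  using expansion by (simp add: has_cfrac_def)

lemma q_pos: "q n > 0"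
  by (rule cf_den_pos) (rule quotient_pos)

lemma q_mono: "m \<le> n \<Longrightarrow> q m \<le> q n"
proof (rule lift_Suc_mono_le[of q])
  fix k
  show "q k \<le> q (Suc k)"
  proof (cases k)
    case 0
    then show ?thesis
      using quotient_pos[of 1] by simp
  next
    case (Suc m)
    have "1 * q (Suc m) \<le> a (Suc (Suc m)) * q (Suc m)"
      using quotient_pos[of "Suc (Suc m)"] q_pos[of "Suc m"] by (intro mult_right_mono) auto
    then show ?thesis
      using q_pos[of m] Suc by (simp add: cf_den.simps)
  qed
qed

lemma q_ge_index: "int n \<le> q n"
proof (induction n)
  case (Suc n)
  show ?case
  proof (cases n)
    case 0
    then show ?thesis
      using quotient_pos[of 1] by simp
  next
    case (Suc m)
    have "1 * q (Suc m) \<le> a (Suc (Suc m)) * q (Suc m)"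
      using quotient_pos[of "Suc (Suc m)"] q_pos[of "Suc m"] by (intro mult_right_mono) auto
    then show ?thesis
      using Suc.IH q_pos[of m] unfolding Suc cf_den.simps by linarith
  qed
qed simp

text \<open>Convergents of equal parity move monotonically towards their limit, from below for even
  and from above for odd indices. Equality is excluded because \<open>\<theta>\<close> is
  irrational.\<close>

lemma gap_pos: "gap n > 0"
proof -
  define c where "c n = real_of_int (p n) / q n" for n
  have lim: "c \<longlonglongrightarrow> \<theta>"
    using expansion fin_cfrac_eq_convergent[of a, OF quotient_pos]
    by (simp add: has_cfrac_def c_def[abs_def])
  have step: "(-1) ^ n * c n \<le> (-1) ^ n * c (Suc (Suc n))" for n
  proof -
    \<comment> \<open>Inserting the recursions leaves a_{n+2} times the determinant of two
      consecutive convergents.\<close>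
    have "(-1) ^ n * (p (Suc (Suc n)) * q n - p n * q (Suc (Suc n))) =
        a (Suc (Suc n)) * ((-1) ^ n * (q n * p (Suc n) - q (Suc n) * p n))"
      by (simp add: cf_num.simps cf_den.simps algebra_simps)
    also have "\<dots> = a (Suc (Suc n))"
      unfolding cf_det by (simp flip: power_mult_distrib)
    finally have "(-1) ^ n * (p (Suc (Suc n)) * q n - p n * q (Suc (Suc n))) \<ge> 0"
      using quotient_pos[of "Suc (Suc n)"] by linarith
    then have "real_of_int ((-1) ^ n * (p (Suc (Suc n)) * q n - p n * q (Suc (Suc n)))) \<ge> 0"
      by (simp only: of_int_0_le_iff)
    then have "0 \<le> (-1) ^ n * (real_of_int (p (Suc (Suc n))) * q n - real_of_int (p n) * q (Suc (Suc n)))"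
      by (simp only: of_int_mult of_int_diff of_int_power of_int_minus of_int_1)
    then have "0 \<le> (-1) ^ n * (real_of_int (p (Suc (Suc n))) * q n - real_of_int (p n) * q (Suc (Suc n)))
        / (real_of_int (q n) * q (Suc (Suc n)))"
      using q_pos[of n] q_pos[of "Suc (Suc n)"] by (intro divide_nonneg_pos mult_pos_pos) simp_all
    also have "\<dots> = (-1) ^ n * (c (Suc (Suc n)) - c n)"
      using q_pos[of n] q_pos[of "Suc (Suc n)"] unfolding c_def
      by (subst diff_frac_eq) (simp_all add: mult_ac)
    finally show ?thesis
      by (simp add: algebra_simps)
  qed
  have "incseq (\<lambda>m. (-1) ^ n * c (n + 2 * m))"
    using step[of "n + 2 * m" for m] by (intro incseq_SucI) (simp add: power_add)
  moreover have "(\<lambda>m. (-1) ^ n * c (n + 2 * m)) \<longlonglongrightarrow> (-1) ^ n * \<theta>"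
    using LIMSEQ_subseq_LIMSEQ[OF lim, of "\<lambda>m. n + 2 * m"]
    by (intro tendsto_mult_left) (simp add: strict_mono_def o_def)
  ultimately have "(-1) ^ n * c (n + 2 * 0) \<le> (-1) ^ n * \<theta>"
    by (rule incseq_le)
  moreover have "gap n = q n * ((-1) ^ n * \<theta> - (-1) ^ n * c n)"
    using q_pos[of n] by (simp add: gap_def c_def field_simps)
  ultimately have "gap n \<ge> 0"
    using q_pos[of n] by simp
  moreover have "gap n \<noteq> 0"
  proof
    assume "gap n = 0"
    then have "\<theta> = p n / q n"
      using q_pos[of n] by (simp add: gap_def field_simps)
    then show False
      using irrational by simp
  qed
  ultimately show ?thesis
    by simp
qed

lemma gap_rec: "gap n = a (Suc (Suc n)) * gap (Suc n) + gap (Suc (Suc n))"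
  by (simp add: gap_def cf_num.simps cf_den.simps algebra_simps)

lemma gap_Suc_less: "gap (Suc n) < gap n"
proof -
  have "1 * gap (Suc n) \<le> a (Suc (Suc n)) * gap (Suc n)"
    using quotient_pos[of "Suc (Suc n)"] gap_pos[of "Suc n"] by (intro mult_right_mono) auto
  then show ?thesis
    using gap_rec[of n] gap_pos[of "Suc (Suc n)"] by simp
qed

text \<open>The factor (-1)^k makes the error of the k-th convergent positive and the determinant
  equal to 1, so both parities of \<open>k\<close> fall under one locale.\<close>

lemma pair:
  "convergent_pair ((-1) ^ k * \<theta>) (gap k) (gap (Suc k))
    ((-1) ^ k * p k) ((-1) ^ k * p (Suc k)) (q k) (q (Suc k))"
proof
  have "q k * ((-1) ^ k * p (Suc k)) - q (Suc k) * ((-1) ^ k * p k) =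
      (-1) ^ k * (q k * p (Suc k) - q (Suc k) * p k)"
    by (simp add: algebra_simps)
  then show "q k * ((-1) ^ k * p (Suc k)) - q (Suc k) * ((-1) ^ k * p k) = 1"
    unfolding cf_det by (simp flip: power_mult_distrib)
qed (simp_all add: q_pos gap_pos, simp_all add: gap_def algebra_simps)

text \<open>Expressed through the errors, the determinant identity reads q_{k+1} \<eta>_k + q_k
  \<eta>_{k+1} = 1.\<close>

lemma gap_le: "gap k \<le> 1 / q (Suc k)"
proof -
  interpret convergent_pair "(-1) ^ k * \<theta>" "gap k" "gap (Suc k)"
    "(-1) ^ k * p k" "(-1) ^ k * p (Suc k)" "q k" "q (Suc k)"
    by (rule pair)
  have "real_of_int (q k * ((-1) ^ k * p (Suc k)) - q (Suc k) * ((-1) ^ k * p k)) = 1"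
    unfolding det by simp
  also have "real_of_int (q k * ((-1) ^ k * p (Suc k)) - q (Suc k) * ((-1) ^ k * p k)) =
      q (Suc k) * gap k + q k * gap (Suc k)"
    by (simp add: gap_def algebra_simps)
  finally have "q (Suc k) * gap k + q k * gap (Suc k) = 1" .
  moreover have "0 < q k * gap (Suc k)"
    using q_pos gap_pos by simp
  ultimately have "q (Suc k) * gap k \<le> 1"
    by linarith
  then show ?thesis
    using q_pos[of "Suc k"] by (simp add: field_simps)
qed

lemma gap_tendsto_0: "gap \<longlonglongrightarrow> 0"
proof (rule tendsto_sandwich[where f = "\<lambda>_. 0" and h = "\<lambda>n. inverse (real (Suc n))"])
  show "\<forall>\<^sub>F n in sequentially. gap n \<le> inverse (real (Suc n))"
  proof (rule always_eventually, rule allI)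
    fix n
    have "real (Suc n) \<le> q (Suc n)"
      using q_ge_index[of "Suc n"] by linarith
    then have "1 / q (Suc n) \<le> 1 / real (Suc n)"
      by (intro divide_left_mono mult_pos_pos) auto
    then show "gap n \<le> inverse (real (Suc n))"
      using gap_le[of n] by (simp add: inverse_eq_divide)
  qed
qed (auto simp: gap_pos less_imp_le intro!: always_eventually simp del: of_nat_Suc intro: LIMSEQ_inverse_real_of_nat)

lemma sign_cases:
  assumes "\<alpha> = \<theta> \<or> \<alpha> = - \<theta>"
  obtains "\<alpha> = (-1) ^ k * \<theta>" | "- \<alpha> = (-1) ^ k * \<theta>"
  using assms by (cases "even k") auto

lemma gap_le_abs:
  fixes \<alpha> :: real and d N :: int
  assumes "\<alpha> = \<theta> \<or> \<alpha> = - \<theta>" "0 < d" "d < q (Suc k)"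
  shows "gap k \<le> \<bar>d * \<alpha> - N\<bar>"
proof -
  interpret convergent_pair "(-1) ^ k * \<theta>" "gap k" "gap (Suc k)"
    "(-1) ^ k * p k" "(-1) ^ k * p (Suc k)" "q k" "q (Suc k)"
    by (rule pair)
  show ?thesis
    using assms(1)
  proof (cases rule: sign_cases[of _ k])
    case 1
    then show ?thesis
      using best_approximation[OF assms(2,3), of N] by simp
  next
    case 2
    then show ?thesis
      using best_approximation[OF assms(2,3), of "- N"] by (simp flip: 2)
  qed
qed

lemma orbit_hits_gap:
  assumes "\<alpha> = \<theta> \<or> \<alpha> = - \<theta>"
  shows "\<exists>i<nat (q k) + nat (q (Suc k)). \<exists>m::int.
    u \<le> z + real i * \<alpha> + m \<and> z + real i * \<alpha> + m < u + gap k"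
proof -
  interpret convergent_pair "(-1) ^ k * \<theta>" "gap k" "gap (Suc k)"
    "(-1) ^ k * p k" "(-1) ^ k * p (Suc k)" "q k" "q (Suc k)"
    by (rule pair)
  show ?thesis
    using assms(1)
  proof (cases rule: sign_cases[of _ k])
    case 1
    show ?thesis
      by (rule orbit_hits_interval[of _ _ "(-1) ^ k * p k" "gap k" _ "(-1) ^ k * p (Suc k)" "gap (Suc k)"])
        (use near pos gap_Suc_less[of k] 1 in \<open>simp_all add: less_imp_le\<close>)
  next
    case 2
    \<comment> \<open>Reflection exchanges the two convergents: now q_{k+1} steps forward advance
      the point, and so do q_k steps back.\<close>
    then have "\<alpha> = - ((-1) ^ k * \<theta>)"
      by simp
    then show ?thesis
      by (subst add.commute,
        intro orbit_hits_interval[of _ _ "- ((-1) ^ k * p (Suc k))" "gap (Suc k)" _ "- ((-1) ^ k * p k)" "gap k"])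
        (use near pos gap_Suc_less[of k] in \<open>simp_all add: less_imp_le\<close>)
  qed
qed


text \<open>Agreement with the shift by \<open>d\<close> means that adding \<open>\<beta>\<close>,
  which is d\<alpha> modulo 1, changes no floor along n + 1 consecutive orbit points. They thus
  avoid an interval of length |\<beta>| \<ge> \<eta>_k, which q_k + q_{k+1} consecutive points
  cannot do. Allowing \<alpha> = -\<theta> covers the words defined by ceilings.\<close>

lemma agreement_length_le:
  fixes \<alpha> \<rho> :: real and j d n k :: nat and x :: "nat \<Rightarrow> int"
  defines "F i \<equiv> \<lfloor>real i * \<alpha> + \<rho>\<rfloor>"
  assumes \<alpha>: "\<alpha> = \<theta> \<or> \<alpha> = - \<theta>" and d: "0 < d" "int d < q (Suc k)"
    and x: "\<And>i. i \<ge> 1 \<Longrightarrow> x i = F (Suc i) - F i"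
    and agree: "j \<ge> 1" "\<And>i. i < n \<Longrightarrow> x (j + i) = x (j + d + i)"
  shows "int n + 2 \<le> q k + q (Suc k)"
proof (rule ccontr)
  assume "\<not> ?thesis"
  then have long: "nat (q k) + nat (q (Suc k)) \<le> Suc n"
    using q_pos[of k] q_pos[of "Suc k"] by linarith
  define G where "G = F (j + d) - F j"
  define \<beta> where "\<beta> = real d * \<alpha> - G"
  \<comment> \<open>The letters are differences of \<open>F\<close>, so \<open>n\<close> equal
    letters give n + 1 equal displacements.\<close>
  have const: "F (j + d + i) - F (j + i) = G" if "i \<le> n" for i
    using that
  proof (induction i)
    case (Suc i)
    then show ?case
      using agree(2)[of i] agree(1) x[of "j + i"] x[of "j + d + i"] by simp
  qed (simp add: G_def)
  have floor_eq: "\<lfloor>real (j + i) * \<alpha> + \<rho> + \<beta>\<rfloor> = \<lfloor>real (j + i) * \<alpha> + \<rho>\<rfloor>" if "i \<le> n" for i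
  proof -
    have "\<lfloor>real (j + i) * \<alpha> + \<rho> + \<beta>\<rfloor> = \<lfloor>real (j + d + i) * \<alpha> + \<rho> - G\<rfloor>"
      by (simp add: \<beta>_def algebra_simps)
    then show ?thesis
      using const[OF that] by (simp add: F_def)
  qed
  have \<beta>: "gap k \<le> \<bar>\<beta>\<bar>"
    using gap_le_abs[OF \<alpha>, of "int d" k G] d by (simp add: \<beta>_def)
  \<comment> \<open>The target interval ends at or before 0 and is pushed to 0 or above when \<beta>
    > 0; it starts at 0 and is pushed below 0 when \<beta> < 0. Either way the floor
    changes.\<close>
  obtain i m where i: "i < nat (q k) + nat (q (Suc k))"
      "min 0 (- \<beta>) \<le> (real j * \<alpha> + \<rho>) + real i * \<alpha> + of_int m"
      "(real j * \<alpha> + \<rho>) + real i * \<alpha> + of_int m < min 0 (- \<beta>) + gap k"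
    using orbit_hits_gap[OF \<alpha>, of k "min 0 (- \<beta>)" "real j * \<alpha> + \<rho>"] by blast
  define y where "y = real (j + i) * \<alpha> + \<rho>"
  have eq: "\<lfloor>y + \<beta>\<rfloor> = \<lfloor>y\<rfloor>"
    using floor_eq[of i] i(1) long by (simp add: y_def)
  have y: "min 0 (- \<beta>) \<le> y + m" "y + m < min 0 (- \<beta>) + gap k"
    using i by (simp_all add: y_def algebra_simps)
  show False
  proof (cases "\<beta> < 0")
    case True
    then have "- m \<le> \<lfloor>y\<rfloor>" "\<lfloor>y + \<beta>\<rfloor> < - m"
      using y \<beta> by (simp_all add: le_floor_iff floor_less_iff)
    then show False
      using eq by simp
  next
    case False
    then have "\<lfloor>y\<rfloor> < - m" "- m \<le> \<lfloor>y + \<beta>\<rfloor>"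
      using y \<beta> by (simp_all add: le_floor_iff floor_less_iff)
    then show False
      using eq by simp
  qed
qed

text \<open>If adding q_k \<theta> - p_k changed the floor, an integer would lie between the two
  values. The window for \<open>\<sigma>\<close>, of length \<eta>_{k+1}, then places l\<theta> so
  close to that integer that \<open>no_early_return\<close> is violated.\<close>

lemma floor_add_q_mult:
  fixes k l :: nat and \<sigma> :: real
  assumes "gap k - gap (Suc k) < - ((-1) ^ k * \<sigma>)" "- ((-1) ^ k * \<sigma>) < gap k"
    and l: "0 < l" "int l < q k + q (Suc k)"
  shows "\<lfloor>real l * \<theta> + \<sigma> + q k * \<theta>\<rfloor> = \<lfloor>real l * \<theta> + \<sigma>\<rfloor> + p k"
proof -
  interpret convergent_pair "(-1) ^ k * \<theta>" "gap k" "gap (Suc k)"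
    "(-1) ^ k * p k" "(-1) ^ k * p (Suc k)" "q k" "q (Suc k)"
    by (rule pair)
  define D where "D = q k * \<theta> - p k"
  have gap: "gap k = (-1) ^ k * D"
    by (simp add: gap_def D_def)
  have none: "\<not> (- gap (Suc k) < l * ((-1) ^ k * \<theta>) - N \<and> l * ((-1) ^ k * \<theta>) - N < gap k)"
    for N :: int
    using no_early_return[of "int l" N] l by simp
  have "\<lfloor>real l * \<theta> + \<sigma> + D\<rfloor> = \<lfloor>real l * \<theta> + \<sigma>\<rfloor>"
  proof (rule ccontr)
    assume neq: "\<not> ?thesis"
    show False
    proof (cases "even k")
      case True
      then have D: "D = gap k"
        using gap by simp
      then have "\<lfloor>real l * \<theta> + \<sigma>\<rfloor> < \<lfloor>real l * \<theta> + \<sigma> + D\<rfloor>"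
        using neq floor_mono[of "real l * \<theta> + \<sigma>" "real l * \<theta> + \<sigma> + D"] pos by auto
      then have "real l * \<theta> + \<sigma> < \<lfloor>real l * \<theta> + \<sigma> + D\<rfloor>"
        by (simp add: floor_less_iff)
      moreover have "- gap (Suc k) < - \<sigma> - gap k" "- \<sigma> < gap k"
        using assms(1,2) True by simp_all
      moreover have "\<lfloor>real l * \<theta> + \<sigma> + D\<rfloor> \<le> real l * \<theta> + \<sigma> + gap k"
        using of_int_floor_le[of "real l * \<theta> + \<sigma> + D"] unfolding D .
      moreover have "\<not> (- gap (Suc k) < l * \<theta> - \<lfloor>real l * \<theta> + \<sigma> + D\<rfloor> \<and>
          l * \<theta> - \<lfloor>real l * \<theta> + \<sigma> + D\<rfloor> < gap k)"
        using none[of "\<lfloor>real l * \<theta> + \<sigma> + D\<rfloor>"] True by simp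
      ultimately show False
        by linarith
    next
      \<comment> \<open>For odd \<open>k\<close> the added term is negative and the picture is
        mirrored, so \<open>none\<close> is applied to the negated integer.\<close>
      case False
      then have D: "D = - gap k"
        using gap by simp
      then have "\<lfloor>real l * \<theta> + \<sigma> + D\<rfloor> < \<lfloor>real l * \<theta> + \<sigma>\<rfloor>"
        using neq floor_mono[of "real l * \<theta> + \<sigma> + D" "real l * \<theta> + \<sigma>"] pos by auto
      then have "real l * \<theta> + \<sigma> + D < \<lfloor>real l * \<theta> + \<sigma>\<rfloor>"
        by (simp add: floor_less_iff)
      moreover have "- gap (Suc k) < \<sigma> - gap k" "\<sigma> < gap k"
        using assms(1,2) False by simp_all
      moreover have "\<lfloor>real l * \<theta> + \<sigma>\<rfloor> \<le> real l * \<theta> + \<sigma>"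
        by (rule of_int_floor_le)
      moreover have "\<not> (- gap (Suc k) < \<lfloor>real l * \<theta> + \<sigma>\<rfloor> - l * \<theta> \<and>
          \<lfloor>real l * \<theta> + \<sigma>\<rfloor> - l * \<theta> < gap k)"
        using none[of "- \<lfloor>real l * \<theta> + \<sigma>\<rfloor>"] False by simp
      ultimately show False
        unfolding D by linarith
    qed
  qed
  moreover have "real l * \<theta> + \<sigma> + q k * \<theta> = real l * \<theta> + \<sigma> + D + p k"
    by (simp add: D_def)
  ultimately show ?thesis
    by (simp only: floor_add_int [symmetric])
qed

end

section \<open>Repetitions in Sturmian words\<close>

lemma rep_length_le:
  assumes "j \<ge> 1" "d \<ge> 1" "\<And>i. i < n \<Longrightarrow> x (j + i) = x (j + d + i)"
  shows "rep_length n x \<le> j + d + n - 1"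
  unfolding rep_length_def
  using assms by (intro Least_le exI[of _ j]) auto

text \<open>Over finitely many letters the pigeonhole principle yields two equal windows, so the
  \<open>LEAST\<close> is attained. Here \<open>d\<close> is the distance between the windows, and
  the last position of the second one is j + d + n - 1.\<close>

lemma rep_length_attained:
  fixes x :: "nat \<Rightarrow> 'a"
  assumes fin: "finite (x ` {1..})"
  shows "\<exists>j d. j \<ge> 1 \<and> d \<ge> 1 \<and> j + d + n = rep_length n x + 1 \<and>
    (\<forall>i<n. x (j + i) = x (j + d + i))"
proof -
  define P where "P m \<longleftrightarrow> (\<exists>j\<ge>1. j + n \<le> m \<and> (\<forall>i<n. x (j + i) = x (m - n + 1 + i)))" for m
  define w where "w j = map (\<lambda>i. x (j + i)) [0..<n]" for j
  have "w ` {1..} \<subseteq> {xs. set xs \<subseteq> x ` {1..} \<and> length xs = n}"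
    by (auto simp: w_def)
  then have "finite (w ` {1..})"
    using finite_lists_length_eq[OF fin] by (rule finite_subset)
  then have "\<not> inj_on w {1..}"
    using finite_imageD infinite_Ici by blast
  then obtain j j' where "1 \<le> j" "1 \<le> j'" "j \<noteq> j'" "w j = w j'"
    by (auto simp: inj_on_def)
  then obtain j j' where jj': "1 \<le> j" "j < j'" "w j = w j'"
    by (metis linorder_neqE_nat)
  then have "P (j' + n - 1)"
    unfolding P_def by (intro exI[of _ j]) (auto simp: w_def)
  then have "P (LEAST m. P m)"
    by (rule LeastI)
  then have "P (rep_length n x)"
    by (simp add: P_def rep_length_def)
  then obtain j where j: "j \<ge> 1" "j + n \<le> rep_length n x"
      "\<And>i. i < n \<Longrightarrow> x (j + i) = x (rep_length n x - n + 1 + i)"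
    by (auto simp: P_def)
  show ?thesis
    by (intro exI[of _ j] exI[of _ "rep_length n x - n + 1 - j"]) (use j in \<open>auto simp: Suc_diff_le\<close>)
qed

section \<open>Lower bound for the exponent of repetition\<close>

context cfrac_expansion
begin

text \<open>The continued fraction of the theorem with its index moved by one:
  \<open>ratio k\<close> starts from a_{k+1}.\<close>

definition ratio :: "nat \<Rightarrow> real" where
  "ratio k = 1 + q k / (q k + q (Suc k))"

text \<open>As j \<ge> 1, a repetition at distance \<open>d\<close> ends no earlier than n + d, and
  \<open>agreement_length_le\<close> bounds \<open>n\<close> from above. The bound on
  \<open>n\<close> is also recorded because it drives \<open>k\<close> to infinity with
  \<open>n\<close>.\<close>

lemma rep_length_lower_bound:
  assumes x: "sturmian_word \<theta> x" and "n > 0"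
  obtains k where "int n \<le> q k + q (Suc k)" "ratio k \<le> rep_length n x / n"
proof -
  have "x ` {1..} \<subseteq> {0, 1}"
    using x by (auto simp: sturmian_word_def)
  then have "finite (x ` {1..})"
    by (rule finite_subset) simp
  then obtain j d where jd: "j \<ge> 1" "d \<ge> 1" "j + d + n = rep_length n x + 1"
      "\<forall>i<n. x (j + i) = x (j + d + i)"
    using rep_length_attained[of x n] by blast
  \<comment> \<open>This index is positive since q_0 = 1 \<le> d; its predecessor \<open>k\<close>
    satisfies q_k \<le> d < q_{k+1}.\<close>
  define k' where "k' = (LEAST k. int d < q k)"
  have "int d < q (Suc d)"
    using q_ge_index[of "Suc d"] by simp
  then have "int d < q k'"
    unfolding k'_def by (rule LeastI)
  then have "k' \<noteq> 0"
    using jd(2) by (cases k') auto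
  then obtain k where k: "k' = Suc k"
    using not0_implies_Suc by blast
  have "q k \<le> d"
    using not_less_Least[of k "\<lambda>k. int d < q k"] k by (simp add: k'_def[symmetric])
  have "int n + 2 \<le> q k + q (Suc k)"
  proof -
    obtain \<rho> where "(\<forall>n\<ge>1. x n = \<lfloor>(real n + 1) * \<theta> + \<rho>\<rfloor> - \<lfloor>real n * \<theta> + \<rho>\<rfloor>) \<or>
        (\<forall>n\<ge>1. x n = \<lceil>(real n + 1) * \<theta> + \<rho>\<rceil> - \<lceil>real n * \<theta> + \<rho>\<rceil>)"
      using x by (auto simp: sturmian_word_def)
    then show ?thesis
    proof
      assume x: "\<forall>n\<ge>1. x n = \<lfloor>(real n + 1) * \<theta> + \<rho>\<rfloor> - \<lfloor>real n * \<theta> + \<rho>\<rfloor>"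
      have "x i = \<lfloor>real (Suc i) * \<theta> + \<rho>\<rfloor> - \<lfloor>real i * \<theta> + \<rho>\<rfloor>" if "i \<ge> 1" for i
        using x that by (simp add: add.commute)
      then show ?thesis
        using jd \<open>int d < q k'\<close> k
        by (intro agreement_length_le[of \<theta> d k x \<rho> j n]) (simp_all del: of_nat_Suc)
    next
      assume x: "\<forall>n\<ge>1. x n = \<lceil>(real n + 1) * \<theta> + \<rho>\<rceil> - \<lceil>real n * \<theta> + \<rho>\<rceil>"
      \<comment> \<open>Negated ceilings are floors of the negated argument, so the negated word is
        a floor word of slope -\<theta>.\<close>
      have "- x i = \<lfloor>real (Suc i) * - \<theta> + - \<rho>\<rfloor> - \<lfloor>real i * - \<theta> + - \<rho>\<rfloor>" if "i \<ge> 1" for i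
        using x that by (simp add: ceiling_def algebra_simps)
      then show ?thesis
        using jd \<open>int d < q k'\<close> k
        by (intro agreement_length_le[of "- \<theta>" d k "\<lambda>i. - x i" "- \<rho>" j n]) (simp_all del: of_nat_Suc)
    qed
  qed
  then have n: "int n \<le> q k + q (Suc k)"
    by simp
  have "real_of_int (q k) / real_of_int (q k + q (Suc k)) \<le> real d / real n"
    using n \<open>q k \<le> d\<close> \<open>n > 0\<close> q_pos[of k]
    by (intro frac_le) auto
  also have "\<dots> \<le> rep_length n x / n - 1"
    using jd \<open>n > 0\<close> by (simp add: field_simps)
  finally show ?thesis
    using n by (intro that[of k]) (simp_all add: ratio_def)
qed

lemma liminf_ratio_le_rep:
  assumes "sturmian_word \<theta> x"
  shows "liminf (\<lambda>k. ereal (ratio k)) \<le> rep x"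
  unfolding rep_def le_Liminf_iff
proof (intro allI impI)
  fix C assume C: "C < liminf (\<lambda>k. ereal (ratio k))"
  then obtain K where K: "\<And>k. k \<ge> K \<Longrightarrow> C < ratio k"
    using less_LiminfD[OF C] by (auto simp: eventually_sequentially)
  show "\<forall>\<^sub>F n in sequentially. C < ereal (rep_length n x / n)"
    unfolding eventually_sequentially
  proof (intro exI allI impI)
    \<comment> \<open>Beyond this threshold, monotonicity of \<open>q\<close> forces the index
      supplied by \<open>rep_length_lower_bound\<close> to be at least \<open>K\<close>.\<close>
    fix n assume n: "nat (q K + q (Suc K)) + 1 \<le> n"
    then have "n > 0"
      by simp
    obtain k where k: "int n \<le> q k + q (Suc k)" "ratio k \<le> rep_length n x / n"
      using rep_length_lower_bound[OF assms \<open>n > 0\<close>] .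
    have "k \<ge> K"
    proof (rule ccontr)
      assume "\<not> k \<ge> K"
      then have "q k \<le> q K" "q (Suc k) \<le> q (Suc K)"
        by (auto intro!: q_mono)
      then show False
        using n k(1) by linarith
    qed
    then have "C < ratio k"
      by (rule K)
    also have "ereal (ratio k) \<le> ereal (rep_length n x / n)"
      using k(2) by simp
    finally show "C < ereal (rep_length n x / n)" .
  qed
qed

section \<open>Words with early repetitions\<close>

definition lower_word :: "real \<Rightarrow> nat \<Rightarrow> int" where
  "lower_word \<rho> n = \<lfloor>(real n + 1) * \<theta> + \<rho>\<rfloor> - \<lfloor>real n * \<theta> + \<rho>\<rfloor>"

lemma sturmian_lower_word:
  assumes "0 < \<theta>" "\<theta> < 1"
  shows "sturmian_word \<theta> (lower_word \<rho>)"
proof -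
  have "lower_word \<rho> n \<in> {0, 1}" for n
  proof -
    define y where "y = real n * \<theta> + \<rho>"
    have "(real n + 1) * \<theta> + \<rho> = y + \<theta>"
      by (simp add: y_def algebra_simps)
    then show ?thesis
      using assms unfolding lower_word_def y_def[symmetric] by simp linarith
  qed
  then show ?thesis
    using assms irrational by (auto simp: sturmian_word_def lower_word_def[abs_def])
qed

text \<open>After \<open>s\<close> steps the orbit of \<open>\<rho>\<close> sits at
  \<open>\<sigma>\<close> modulo 1, where \<open>floor_add_q_mult\<close> applies; the repetition at
  distance q_k starts at position s + 1.\<close>

lemma rep_length_lower_word_le:
  fixes k s :: nat and M :: int and \<rho> :: real
  defines "\<sigma> \<equiv> \<rho> + real s * \<theta> - M"
  assumes \<sigma>: "gap k - gap (Suc k) < - ((-1) ^ k * \<sigma>)" "- ((-1) ^ k * \<sigma>) < gap k"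
    and n: "int n + 2 \<le> q k + q (Suc k)"
  shows "rep_length n (lower_word \<rho>) \<le> s + nat (q k) + n"
proof -
  \<comment> \<open>Comparing \<open>n\<close> letters takes the floors at n + 1 positions, and n +
    1 < q_k + q_{k+1} is what the bound on \<open>n\<close> provides.\<close>
  have shift: "\<lfloor>real (s + l + nat (q k)) * \<theta> + \<rho>\<rfloor> = \<lfloor>real (s + l) * \<theta> + \<rho>\<rfloor> + p k"
    if "0 < l" "l \<le> n + 1" for l
  proof -
    have "real (s + l + nat (q k)) * \<theta> + \<rho> = real l * \<theta> + \<sigma> + q k * \<theta> + M"
      using q_pos[of k] by (simp add: \<sigma>_def algebra_simps)
    moreover have "real (s + l) * \<theta> + \<rho> = real l * \<theta> + \<sigma> + M"
      by (simp add: \<sigma>_def algebra_simps)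
    moreover have "int l < q k + q (Suc k)"
      using that n by simp
    ultimately show ?thesis
      using floor_add_q_mult[OF \<sigma> that(1)] by (simp only: floor_add_int [symmetric])
  qed
  have "rep_length n (lower_word \<rho>) \<le> Suc s + nat (q k) + n - 1"
  proof (rule rep_length_le)
    show "nat (q k) \<ge> 1"
      using q_pos[of k] by simp
    fix i assume "i < n"
    then show "lower_word \<rho> (Suc s + i) = lower_word \<rho> (Suc s + nat (q k) + i)"
      using shift[of "Suc i"] shift[of "Suc (Suc i)"]
      by (simp add: lower_word_def algebra_simps)
  qed simp
  then show ?thesis
    by simp
qed

lemma frequently_ratio_less:
  assumes "liminf (\<lambda>k. ereal (ratio k)) < ereal c"
  shows "\<exists>k\<ge>K. ratio k < c"
proof (rule ccontr)
  assume "\<not> ?thesis"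
  then have "\<forall>\<^sub>F k in sequentially. ereal c \<le> ereal (ratio k)"
    unfolding eventually_sequentially by (intro exI[of _ K]) auto
  then have "ereal c \<le> liminf (\<lambda>k. ereal (ratio k))"
    by (rule Liminf_bounded)
  then show False
    using assms by simp
qed


section \<open>Density of good intercepts and Baire's theorem\<close>

definition good :: "real \<Rightarrow> nat \<Rightarrow> real \<Rightarrow> bool" where
  "good c m \<rho> \<longleftrightarrow> (\<exists>n\<ge>m. rep_length n (lower_word \<rho>) / n < c)"

text \<open>Choose z = -s\<theta> + M close to \<open>y\<close>. Intercepts in a short interval
  beside \<open>z\<close> repeat almost optimally after a delay of \<open>s\<close> letters, and as
  \<open>s\<close> is fixed before \<open>k\<close>, the cost s/n becomes negligible.\<close>

lemma good_near:
  assumes c: "liminf (\<lambda>k. ereal (ratio k)) < ereal c" "c < c'" and "\<epsilon> > 0"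
  obtains V \<rho> where "open V" "\<rho> \<in> V" "dist \<rho> y < \<epsilon>" "\<And>\<rho>'. \<rho>' \<in> V \<Longrightarrow> good c' m \<rho>'"
proof -
  have "\<forall>\<^sub>F k in sequentially. gap k < \<epsilon> / 2"
    using gap_tendsto_0 \<open>\<epsilon> > 0\<close> by (intro order_tendstoD(2)) auto
  then obtain K where K: "\<And>k. k \<ge> K \<Longrightarrow> gap k < \<epsilon> / 2"
    unfolding eventually_sequentially by blast
  obtain s :: nat and M :: int where sM: "y \<le> 0 + real s * - \<theta> + M" "0 + real s * - \<theta> + M < y + gap K"
    using orbit_hits_gap[of "- \<theta>" K y 0] by blast
  define z where "z = real s * - \<theta> + M"
  have z: "y \<le> z" "z < y + \<epsilon> / 2"
    using sM K[of K] by (simp_all add: z_def)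
  \<comment> \<open>This makes (s + 2)/n smaller than the slack c' - c once n \<ge> K'.\<close>
  obtain K' :: nat where K': "(s + 2) / (c' - c) < K'"
    using reals_Archimedean2 by blast
  obtain k where k: "k \<ge> K + K' + m + 3" "ratio k < c"
    using frequently_ratio_less[OF c(1)] by blast
  define N where "N = q k + q (Suc k)"
  \<comment> \<open>The greatest window length for which \<open>rep_length_lower_word_le\<close>
    applies.\<close>
  define n where "n = nat (N - 2)"
  have N: "int k + 2 \<le> N"
    using q_ge_index[of k] q_ge_index[of "Suc k"] k(1) by (simp add: N_def)
  then have n: "int n + 2 = N" "k \<le> n" "n > 0"
    using k(1) by (simp_all add: n_def)
  have good: "good c' m \<rho>'"
    if "gap k - gap (Suc k) < - ((-1) ^ k * (\<rho>' - z))" "- ((-1) ^ k * (\<rho>' - z)) < gap k" for \<rho>'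
    unfolding good_def
  proof (intro exI[of _ n] conjI)
    have "rep_length n (lower_word \<rho>') \<le> s + nat (q k) + n"
    proof (rule rep_length_lower_word_le)
      have eq: "\<rho>' + real s * \<theta> - M = \<rho>' - z"
        by (simp add: z_def)
      show "gap k - gap (Suc k) < - ((-1) ^ k * (\<rho>' + real s * \<theta> - M))"
        and "- ((-1) ^ k * (\<rho>' + real s * \<theta> - M)) < gap k"
        unfolding eq by (fact that)+
    qed (use n(1) in \<open>simp add: N_def\<close>)
    then have "real (rep_length n (lower_word \<rho>')) \<le> s + q k + n"
      using q_pos[of k] by linarith
    then have "rep_length n (lower_word \<rho>') / n \<le> (s + q k + n) / n"
      by (rule divide_right_mono) simp
    \<comment> \<open>Passing from the denominator n to N = n + 2 costs 2(q_k/N)/n, which joins the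
      error term.\<close>
    also have "\<dots> = 1 + q k / N + (s + 2 * (q k / N)) / n"
    proof -
      define t where "t = q k / N"
      have "real_of_int N = n + 2"
        using n(1) by linarith
      then have "q k = t * (n + 2)"
        by (simp add: t_def)
      then have "(s + q k + n) / n = 1 + t + (s + 2 * t) / n"
        using n(3) by (simp add: field_simps)
      then show ?thesis
        by (simp add: t_def)
    qed
    also have "\<dots> \<le> 1 + q k / N + (s + 2 * 1) / n"
    proof -
      have "q k / N \<le> 1"
        using q_pos[of k] q_pos[of "Suc k"] by (simp add: N_def)
      then show ?thesis
        by (intro add_left_mono divide_right_mono mult_left_mono) auto
    qed
    also have "(s + 2 * 1) / n < c' - c"
    proof -
      have "(s + 2) / (c' - c) < n"
        using K' k(1) n(2) by linarith
      then show ?thesis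
        using c(2) n(3) by (simp add: field_simps)
    qed
    also have "1 + q k / N = ratio k"
      by (simp add: ratio_def N_def)
    finally show "rep_length n (lower_word \<rho>') / n < c'"
      using k(2) by simp
  qed (use n(2) k(1) in simp)
  define V where "V = {\<rho>'. gap k - gap (Suc k) < - ((-1) ^ k * (\<rho>' - z)) \<and> - ((-1) ^ k * (\<rho>' - z)) < gap k}"
  \<comment> \<open>The midpoint of the interval \<open>V\<close>.\<close>
  define \<rho> where "\<rho> = z - (-1) ^ k * (gap k - gap (Suc k) / 2)"
  have "open V"
    unfolding V_def by (intro open_Collect_conj open_Collect_less continuous_intros)
  moreover have "(-1) ^ k * (\<rho> - z) = - (gap k - gap (Suc k) / 2)"
    by (cases "even k") (simp_all add: \<rho>_def)
  then have "\<rho> \<in> V"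
    using gap_pos[of "Suc k"] by (simp add: V_def)
  moreover have "dist \<rho> y < \<epsilon>"
  proof -
    have "\<bar>\<rho> - z\<bar> = gap k - gap (Suc k) / 2"
      using gap_Suc_less[of k] gap_pos[of "Suc k"] by (simp add: \<rho>_def abs_mult power_abs)
    also have "\<dots> < \<epsilon> / 2"
      using K[of k] k(1) gap_pos[of "Suc k"] by simp
    finally show ?thesis
      using z unfolding dist_real_def by linarith
  qed
  ultimately show ?thesis
    using good by (intro that[of V \<rho>]) (auto simp: V_def)
qed

text \<open>An intercept that is good for every \<open>m\<close>, with tolerance 1/(m + 1) and some
  n \<ge> m, has the required exponent. Such an intercept exists by Baire's theorem.\<close>

lemma exists_word_rep_le:
  assumes l: "liminf (\<lambda>k. ereal (ratio k)) = ereal l"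
  obtains \<rho> where "rep (lower_word \<rho>) \<le> ereal l"
proof -
  \<comment> \<open>The interior of the set of good intercepts, hence open by construction;
    \<open>good_near\<close> makes it dense.\<close>
  define G where "G m = \<Union>{V. open V \<and> (\<forall>\<rho>\<in>V. good (l + 1 / Suc m) m \<rho>)}" for m
  have "openin (top_of_set UNIV) (G m) \<and> UNIV \<subseteq> closure (G m)" for m
  proof
    show "openin (top_of_set UNIV) (G m)"
      by (auto simp: G_def)
    show "UNIV \<subseteq> closure (G m)"
    proof
      fix y :: real
      show "y \<in> closure (G m)"
        unfolding closure_approachable
      proof (intro allI impI)
        fix \<epsilon> :: real assume "\<epsilon> > 0"
        obtain V \<rho> where "open V" "\<rho> \<in> V" "dist \<rho> y < \<epsilon>"
            "\<And>\<rho>'. \<rho>' \<in> V \<Longrightarrow> good (l + 1 / Suc m) m \<rho>'"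
        \<comment> \<open>Half of the tolerance lies strictly between the lower limit and the
          target, as \<open>good_near\<close> requires.\<close>
        proof (rule good_near[of "l + 1 / (2 * Suc m)" "l + 1 / Suc m" \<epsilon> y m])
          show "liminf (\<lambda>k. ereal (ratio k)) < ereal (l + 1 / (2 * Suc m))"
            unfolding l by simp
        qed (use \<open>\<epsilon> > 0\<close> in \<open>simp_all add: field_simps\<close>)
        then show "\<exists>\<rho>\<in>G m. dist \<rho> y < \<epsilon>"
          by (auto simp: G_def)
      qed
    qed
  qed
  then have "UNIV \<subseteq> closure (\<Inter>(range G))"
    by (intro Baire) auto
  then obtain \<rho> where "\<And>m. \<rho> \<in> G m"
    by (cases "\<Inter>(range G) = {}") auto
  then have good: "good (l + 1 / Suc m) m \<rho>" for m
    by (force simp: G_def)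
  have "rep (lower_word \<rho>) \<le> ereal l"
  proof (rule ccontr)
    assume "\<not> ?thesis"
    then obtain c where c: "ereal l < ereal c" "ereal c < rep (lower_word \<rho>)"
      using ereal_dense2[of "ereal l" "rep (lower_word \<rho>)"] by (meson not_le)
    then obtain K where K: "\<And>n. n \<ge> K \<Longrightarrow> ereal c < ereal (rep_length n (lower_word \<rho>) / n)"
      using less_LiminfD[OF c(2)[unfolded rep_def]] by (auto simp: eventually_sequentially)
    obtain m where m: "1 / real (Suc m) < c - l"
      using reals_Archimedean[of "c - l"] c(1) by (auto simp: inverse_eq_divide)
    \<comment> \<open>Goodness at index m + K gives both n \<ge> K and a tolerance below c -
      l.\<close>
    have "1 / real (Suc (m + K)) \<le> 1 / real (Suc m)"
      by (intro divide_left_mono) auto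
    moreover obtain n where "n \<ge> m + K" "rep_length n (lower_word \<rho>) / n < l + 1 / Suc (m + K)"
      using good[of "m + K"] by (auto simp: good_def)
    ultimately show False
      using K[of n] m by simp
  qed
  then show ?thesis
    by (rule that)
qed

section \<open>Finiteness and continued fraction form of the lower limit\<close>

lemma liminf_ratio_real:
  obtains l where "liminf (\<lambda>k. ereal (ratio k)) = ereal l"
proof -
  have "ereal 1 \<le> liminf (\<lambda>k. ereal (ratio k))"
    using q_pos by (intro Liminf_bounded always_eventually) (auto simp: ratio_def add_pos_pos less_imp_le)
  moreover have "liminf (\<lambda>k. ereal (ratio k)) \<le> ereal 2"
    using q_pos by (intro Liminf_le always_eventually) (auto simp: ratio_def add_pos_pos less_imp_le)
  ultimately show ?thesis
    by (cases "liminf (\<lambda>k. ereal (ratio k))") (auto intro: that)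
qed

text \<open>The terms match after a shift of the index by one, which leaves a lower limit unchanged;
  the term at k = 0 drops out.\<close>

lemma liminf_fin_cfrac_eq:
  "liminf (\<lambda>k. ereal (fin_cfrac (1 # (1 + a k) # map a (rev [1..<k])))) = liminf (\<lambda>k. ereal (ratio k))"
proof -
  have "ereal (fin_cfrac (1 # (1 + a (Suc k)) # map a (rev [1..<Suc k]))) = ereal (ratio k)" for k
    using fin_cfrac_target_eq[of a k, OF quotient_pos] by (simp only: ratio_def of_int_add)
  then show ?thesis
    using liminf_shift[of "\<lambda>k. ereal (fin_cfrac (1 # (1 + a k) # map a (rev [1..<k])))"]
    by (simp del: fin_cfrac.simps upt_Suc)
qed

end

theorem theorem1p3:
  fixes \<theta> :: real and a :: "nat \<Rightarrow> int"
  assumes "\<theta> \<notin> \<rat>" and "0 < \<theta>" and "\<theta> < 1"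
    and "has_cfrac \<theta> a" and "a 0 = 0"
    and "\<exists>B. \<forall>n. \<bar>a n\<bar> \<le> B"
  shows "\<exists>m. m \<in> rep_spectrum \<theta> \<and> (\<forall>y\<in>rep_spectrum \<theta>. m \<le> y) \<and>
    m = liminf (\<lambda>k. ereal (fin_cfrac (1 # (1 + a k) # map a (rev [1..<k]))))"
proof -
  interpret cfrac_expansion \<theta> a
    using assms by unfold_locales
  define L where "L = liminf (\<lambda>k. ereal (ratio k))"
  obtain l where l: "L = ereal l"
    unfolding L_def by (rule liminf_ratio_real)
  obtain \<rho> where "rep (lower_word \<rho>) \<le> L"
    using exists_word_rep_le[of l] l by (auto simp: L_def)
  moreover have sturmian: "sturmian_word \<theta> (lower_word \<rho>)"
    using assms by (intro sturmian_lower_word)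
  ultimately have "rep (lower_word \<rho>) = L"
    using liminf_ratio_le_rep[OF sturmian] by (simp add: L_def)
  then have "L \<in> rep_spectrum \<theta>"
    using sturmian by (auto simp: rep_spectrum_def)
  moreover have "\<forall>y\<in>rep_spectrum \<theta>. L \<le> y"
    using liminf_ratio_le_rep by (auto simp: rep_spectrum_def L_def)
  ultimately show ?thesis
    unfolding liminf_fin_cfrac_eq L_def by blast
qed

end
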